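(* Let $R$ be a commutative ring with nonzero identity, let $M$ be the Jacobson radical of $R$, and let $I$ be an ideal of $R$. (1) If $R$ is not local, then $I$ is an $OA$-ideal of $R$ if and only if $I$ is a prime ideal of $R$. (2) If $R$ is local, then $I$ is an $OA$-ideal of $R$ if and only if $I$ is a prime ideal of $R$ or $M^2\subseteq I\subseteq M$. (3) Every $OA$-ideal of $R$ is both a primary ideal and a $TA$-ideal. In particular, every $OAF$-ring is both a $Q$-ring and a $TAF$-ring.
   Context: All rings are commutative with nonzero identity. An ideal $I$ of a ring $R$ is proper if $I\neq R$. A ring is local if it has exactly one maximal ideal (no Noetherian assumption). A proper ideal $I$ of $R$ is an $OA$-ideal ($1$-absorbing prime ideal) if whenever $a,b,c\in R$ are nonunits with $abc\in I$, then $ab\in I$ or $c\in I$. A proper ideal $I$ of $R$ is a $TA$-ideal ($2$-absorbing ideal) if whenever $a,b,c\in R$ and $abc\in I$, then $ab\in I$ or $ac\in I$ or $bc\in I$. A ring is an $OAF$-ring if every proper ideal is a finite product (of at least one factor) of $OA$-ideals; it is a $TAF$-ring if every proper ideal is a finite product of $TA$-ideals; it is a $Q$-ring if every proper ideal is a finite product of primary ideals. *)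

theory Defs
  imports "HOL-Algebra.Ideal_Product"
begin

locale nonzero_cring = cring +
  assumes one_not_zero: "\<one> \<noteq> \<zero>"

locale local_cring = nonzero_cring +
  assumes unique_maximalideal: "\<exists>!N. maximalideal N R"

text \<open>The intersection with the carrier only matters for the zero ring, which has no maximal ideals:
  it turns the empty intersection into the whole ring instead of \<^term>\<open>UNIV\<close>.\<close>

definition jacobson_radical :: "('a, 'b) ring_scheme \<Rightarrow> 'a set"
  where "jacobson_radical R = carrier R \<inter> \<Inter>{N. maximalideal N R}"

text \<open>1-absorbing prime ideals\<close>

locale oa_ideal = ideal + cring +
  assumes I_notcarr: "carrier R \<noteq> I"
    and I_one_absorbing:
      "\<lbrakk>a \<in> carrier R - Units R; b \<in> carrier R - Units R; c \<in> carrier R - Units R;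
        a \<otimes> b \<otimes> c \<in> I\<rbrakk> \<Longrightarrow> a \<otimes> b \<in> I \<or> c \<in> I"

text \<open>2-absorbing ideals\<close>

locale ta_ideal = ideal + cring +
  assumes I_notcarr: "carrier R \<noteq> I"
    and I_two_absorbing:
      "\<lbrakk>a \<in> carrier R; b \<in> carrier R; c \<in> carrier R; a \<otimes> b \<otimes> c \<in> I\<rbrakk>
        \<Longrightarrow> a \<otimes> b \<in> I \<or> a \<otimes> c \<in> I \<or> b \<otimes> c \<in> I"

locale primary_ideal = ideal + cring +
  assumes I_notcarr: "carrier R \<noteq> I"
    and I_primary:
      "\<lbrakk>a \<in> carrier R; b \<in> carrier R; a \<otimes> b \<in> I\<rbrakk>
        \<Longrightarrow> a \<in> I \<or> (\<exists>n::nat. n > 0 \<and> b [^] n \<in> I)"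

text \<open>\<open>is_finite_ideal_prod R P I\<close>: \<open>I\<close> is a product of finitely many, and at least one, ideals
  satisfying \<open>P\<close>. Repeated factors are allowed. The final argument of \<^const>\<open>foldr\<close>
  is the neutral element of ideal multiplication.\<close>

definition is_finite_ideal_prod ::
    "('a, 'b) ring_scheme \<Rightarrow> ('a set \<Rightarrow> bool) \<Rightarrow> 'a set \<Rightarrow> bool"
  where "is_finite_ideal_prod R P I \<longleftrightarrow>
    (\<exists>Js. Js \<noteq> [] \<and> (\<forall>J \<in> set Js. ideal J R \<and> P J) \<and> I = foldr (ideal_prod R) Js (carrier R))"

locale oaf_ring = nonzero_cring +
  assumes oa_factorization:
    "\<lbrakk>ideal J R; J \<noteq> carrier R\<rbrakk> \<Longrightarrow> is_finite_ideal_prod R (\<lambda>K. oa_ideal K R) J"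

locale taf_ring = nonzero_cring +
  assumes ta_factorization:
    "\<lbrakk>ideal J R; J \<noteq> carrier R\<rbrakk> \<Longrightarrow> is_finite_ideal_prod R (\<lambda>K. ta_ideal K R) J"

locale q_ring = nonzero_cring +
  assumes primary_factorization:
    "\<lbrakk>ideal J R; J \<noteq> carrier R\<rbrakk> \<Longrightarrow> is_finite_ideal_prod R (\<lambda>K. primary_ideal K R) J"

end

theory Submission
  imports Defs "HOL-Algebra.Ring_Divisibility"
begin

text \<open>Let \<open>I\<close> be a 1-absorbing prime ideal that is not prime, say \<open>a b \<in> I\<close> with \<open>a, b \<notin> I\<close>; then
  \<open>a\<close> and \<open>b\<close> are nonunits. For a nonunit \<open>x\<close>, absorbing \<open>x a b \<in> I\<close> gives \<open>x a \<in> I\<close>; for nonunits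
  \<open>x, y\<close>, absorbing \<open>x y a \<in> I\<close> then gives \<open>x y \<in> I\<close>. If \<open>x\<close> and \<open>y\<close> were nonunits with \<open>x + y\<close> a
  unit, then \<open>(x + y) a \<in> I\<close> would put \<open>a\<close> in \<open>I\<close>. So the nonunits form an ideal \<open>M\<close>, the ring is
  local and \<open>M\<^sup>2 \<subseteq> I\<close>.\<close>

section \<open>Units, proper ideals and maximal ideals\<close>

lemma (in ideal) unit_mult_cancel:
  assumes "u \<in> Units R" "x \<in> carrier R" "u \<otimes> x \<in> I"
  shows "x \<in> I"
proof -
  have "inv u \<otimes> (u \<otimes> x) \<in> I"
    using assms I_l_closed by blast
  then show ?thesis
    using assms by (simp add: m_assoc[symmetric] Units_closed)
qed

lemma (in ideal) proper_disjoint_Units: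
  assumes "I \<noteq> carrier R"
  shows "I \<inter> Units R = {}"
proof (rule equals0I)
  fix u assume "u \<in> I \<inter> Units R"
  then have "\<one> \<in> I"
    using unit_mult_cancel[of u \<one>] by (simp add: Units_closed)
  then show False
    using one_imp_carrier assms by simp
qed

text \<open>Zorn's lemma, applied to the proper ideals above \<open>I\<close>.\<close>

lemma (in cring) exists_maximalideal_above:
  assumes "ideal I R" "I \<noteq> carrier R"
  obtains N where "maximalideal N R" "I \<subseteq> N"
proof -
  \<comment> \<open>Properness is stated as \<open>\<one> \<notin> J\<close> because this form
    passes to the union of a chain.\<close>
  define S where "S = {J. ideal J R \<and> \<one> \<notin> J \<and> I \<subseteq> J}"
  have "I \<in> S"
    using assms ideal.one_imp_carrier unfolding S_def by auto
  have "\<exists>N\<in>S. \<forall>J\<in>S. N \<subseteq> J \<longrightarrow> J = N"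
  proof (rule subset_Zorn)
    fix C assume C: "subset.chain S C"
    show "\<exists>U\<in>S. \<forall>J\<in>C. J \<subseteq> U"
    proof (cases "C = {}")
      case True
      then show ?thesis
        using \<open>I \<in> S\<close> by blast
    next
      case False
      \<comment> \<open>Only the ideal property is kept here, as \<open>chain_Union_is_ideal\<close>
        speaks of chains among all ideals.\<close>
      have "subset.chain {J. ideal J R} C"
        using C by (auto simp: S_def subset_chain_def)
      then have "ideal (\<Union>C) R"
        using chain_Union_is_ideal[of C] False by simp
      moreover have "\<And>J. J \<in> C \<Longrightarrow> \<one> \<notin> J \<and> I \<subseteq> J"
        using C by (auto simp: S_def subset_chain_def)
      then have "\<one> \<notin> \<Union>C" "I \<subseteq> \<Union>C"
        using False by blast+
      ultimately have "\<Union>C \<in> S"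
        unfolding S_def by simp
      then show ?thesis
        by (rule bexI[rotated]) (simp add: Union_upper)
    qed
  qed
  then obtain N where N: "N \<in> S" "\<forall>J\<in>S. N \<subseteq> J \<longrightarrow> J = N" ..
  have "maximalideal N R"
  proof (rule maximalidealI)
    show "ideal N R" "carrier R \<noteq> N"
      using N(1) unfolding S_def by auto
    fix J assume J: "ideal J R" "N \<subseteq> J"
    show "J = N \<or> J = carrier R"
    proof (cases "\<one> \<in> J")
      case True
      then show ?thesis
        using ideal.one_imp_carrier J(1) by blast
    next
      case False
      then show ?thesis
        using J N unfolding S_def by blast
    qed
  qed
  then show thesis
    using that N(1) unfolding S_def by blast
qed

text \<open>Any maximal ideal above \<open>PIdl x\<close> will do: were \<open>PIdl x\<close> not
  proper, \<open>\<one>\<close> would be a multiple of \<open>x\<close>.\<close>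

lemma (in cring) nonunit_in_maximalideal:
  assumes "x \<in> carrier R - Units R"
  obtains N where "maximalideal N R" "x \<in> N"
proof -
  have x: "x \<in> carrier R"
    using assms by simp
  have "PIdl x \<noteq> carrier R"
  proof
    assume "PIdl x = carrier R"
    then obtain y where "y \<in> carrier R" "\<one> = y \<otimes> x"
      unfolding cgenideal_def by blast
    then show False
      using assms x unit_factor[of x y] Units_one_closed by (metis DiffE m_comm)
  qed
  then show thesis
    using exists_maximalideal_above[OF cgenideal_ideal[OF x]] cgenideal_self[OF x] that by blast
qed

section \<open>The Jacobson radical of a local ring\<close>

lemma (in local_cring) jacobson_radical_maximalideal:
  "maximalideal (jacobson_radical R) R"
  and maximalideal_eq_jacobson_radical: "maximalideal N R \<Longrightarrow> N = jacobson_radical R"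
proof -
  obtain L where L: "maximalideal L R" "\<And>N. maximalideal N R \<Longrightarrow> N = L"
    using unique_maximalideal by blast
  then have "{N. maximalideal N R} = {L}"
    by blast
  moreover have "L \<subseteq> carrier R"
    using ideal.Icarr[OF maximalideal.axioms(1)[OF L(1)]] by (rule subsetI)
  ultimately have "jacobson_radical R = L"
    unfolding jacobson_radical_def by (simp add: Int_absorb1)
  then show "maximalideal (jacobson_radical R) R"
    and "maximalideal N R \<Longrightarrow> N = jacobson_radical R"
    using L by metis+
qed

text \<open>Each nonunit lies in some maximal ideal, and there is only one. This links the radical
  to the absorbing condition, which quantifies over nonunits.\<close>

lemma (in local_cring) jacobson_radical_eq_nonunits:
  "jacobson_radical R = carrier R - Units R"
proof -
  interpret M: maximalideal "jacobson_radical R" R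
    by (rule jacobson_radical_maximalideal)
  have "x \<in> jacobson_radical R" if "x \<in> carrier R - Units R" for x
    using nonunit_in_maximalideal[OF that] maximalideal_eq_jacobson_radical by metis
  moreover have "jacobson_radical R \<inter> Units R = {}"
    using M.proper_disjoint_Units M.I_notcarr by blast
  ultimately show ?thesis
    using M.Icarr by blast
qed

lemma (in local_cring) proper_ideal_subset_jacobson_radical:
  assumes "ideal J R" "J \<noteq> carrier R"
  shows "J \<subseteq> jacobson_radical R"
  by (rule exists_maximalideal_above[OF assms]) (drule maximalideal_eq_jacobson_radical, simp)

section \<open>Prime ideals and ideals between the squared radical and the radical\<close>

lemma (in primeideal) oa_ideal: "oa_ideal I R"
  by unfold_locales (use I_notcarr I_prime in auto)

lemma (in primeideal) primary_ideal: "primary_ideal I R"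
proof unfold_locales
  fix a b assume "a \<in> carrier R" "b \<in> carrier R" "a \<otimes> b \<in> I"
  \<comment> \<open>The exponent is spelled out to serve as the positive witness.\<close>
  then have "a \<in> I \<or> b [^] (1::nat) \<in> I"
    using I_prime by auto
  then show "a \<in> I \<or> (\<exists>n::nat. n > 0 \<and> b [^] n \<in> I)"
    using zero_less_one by blast
qed (rule I_notcarr)

lemma (in primeideal) ta_ideal: "ta_ideal I R"
proof unfold_locales
  fix a b c assume "a \<in> carrier R" "b \<in> carrier R" "c \<in> carrier R" "a \<otimes> b \<otimes> c \<in> I"
  then show "a \<otimes> b \<in> I \<or> a \<otimes> c \<in> I \<or> b \<otimes> c \<in> I"
    using I_prime[of "a \<otimes> b" c] I_l_closed by auto
qed (rule I_notcarr)

text \<open>The first alternative of absorption always holds: two nonunits lie in the radical, so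
  their product lies in its square.\<close>

lemma (in local_cring) oa_ideal_if_square_jacobson_radical_subset:
  assumes "ideal I R" "jacobson_radical R \<cdot> jacobson_radical R \<subseteq> I" "I \<subseteq> jacobson_radical R"
  shows "oa_ideal I R"
proof -
  interpret ideal I R by fact
  show ?thesis
  proof unfold_locales
    show "carrier R \<noteq> I"
      using assms(3) jacobson_radical_eq_nonunits by blast
    fix a b c assume "a \<in> carrier R - Units R" "b \<in> carrier R - Units R"
    then have "a \<otimes> b \<in> I"
      using assms(2) ideal_prod.prod[of a "jacobson_radical R" b] jacobson_radical_eq_nonunits
      by blast
    then show "a \<otimes> b \<in> I \<or> c \<in> I" ..
  qed
qed

section \<open>Consequences of the 1-absorbing condition\<close>

context oa_ideal
begin

text \<open>Isolates the one element that both facts about nonunits below are tested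
  against.\<close>

lemma non_prime_witness:
  assumes "\<not> primeideal I R"
  obtains a where "a \<in> carrier R - Units R" "a \<notin> I" "\<And>x. x \<in> carrier R - Units R \<Longrightarrow> x \<otimes> a \<in> I"
proof -
  \<comment> \<open>\<open>primeidealCE\<close> has a second case, \<open>I\<close> being the whole
    ring, which properness excludes.\<close>
  obtain a b where ab: "a \<in> carrier R" "b \<in> carrier R" "a \<otimes> b \<in> I" "a \<notin> I" "b \<notin> I"
    by (rule primeidealCE[OF is_cring assms]) (use I_notcarr in blast)+
  have a: "a \<notin> Units R"
    using unit_mult_cancel[of a b] ab by blast
  have b: "b \<notin> Units R"
    using unit_mult_cancel[of b a] ab by (auto simp: m_comm)
  have "x \<otimes> a \<in> I" if x: "x \<in> carrier R - Units R" for x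
  proof -
    have "x \<otimes> a \<otimes> b \<in> I"
      using x ab I_l_closed by (simp add: m_assoc)
    then show ?thesis
      using I_one_absorbing[of x a b] x a b ab by blast
  qed
  then show thesis
    using that ab a by blast
qed

lemma nonunit_mult_in_ideal:
  assumes "\<not> primeideal I R" "x \<in> carrier R - Units R" "y \<in> carrier R - Units R"
  shows "x \<otimes> y \<in> I"
proof -
  obtain a where a: "a \<in> carrier R - Units R" "a \<notin> I" "\<And>x. x \<in> carrier R - Units R \<Longrightarrow> x \<otimes> a \<in> I"
    using non_prime_witness[OF assms(1)] by blast
  have "x \<otimes> y \<otimes> a \<in> I"
    using assms a I_l_closed by (simp add: m_assoc)
  then show ?thesis
    using I_one_absorbing[of x y a] a assms by blast
qed

lemma nonunits_add_closed:
  assumes "\<not> primeideal I R" "x \<in> carrier R - Units R" "y \<in> carrier R - Units R"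
  shows "x \<oplus> y \<in> carrier R - Units R"
proof -
  obtain a where a: "a \<in> carrier R - Units R" "a \<notin> I" "\<And>x. x \<in> carrier R - Units R \<Longrightarrow> x \<otimes> a \<in> I"
    using non_prime_witness[OF assms(1)] by blast
  have "(x \<oplus> y) \<otimes> a \<in> I"
    using a assms by (simp add: l_distr)
  then show ?thesis
    using unit_mult_cancel[of "x \<oplus> y" a] a assms by blast
qed

text \<open>Multiples of a nonunit are nonunits because factors of a unit are units; only sums need
  the absorbing ideal.\<close>

lemma nonunits_ideal:
  assumes "\<not> primeideal I R"
  shows "ideal (carrier R - Units R) R"
proof -
  have mult: "x \<otimes> y \<in> carrier R - Units R" if "x \<in> carrier R - Units R" "y \<in> carrier R" for x y
    using that unit_factor by blast
  \<comment> \<open>\<open>\<zero>\<close> lies in the proper ideal \<open>I\<close>, which contains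
    no unit.\<close>
  have "\<zero> \<notin> Units R"
    using proper_disjoint_Units[OF I_notcarr[symmetric]]
      additive_subgroup.zero_closed[OF additive_subgroup_axioms] by blast
  \<comment> \<open>Negation is multiplication by \<open>\<ominus> \<one>\<close>.\<close>
  moreover have "\<ominus> x \<in> carrier R - Units R" if "x \<in> carrier R - Units R" for x
    using mult[OF that, of "\<ominus> \<one>"] that by (simp add: r_minus)
  ultimately have "subgroup (carrier R - Units R) (add_monoid R)"
    using nonunits_add_closed[OF assms]
    by unfold_locales (simp_all flip: a_inv_def)
  moreover have "y \<otimes> x \<in> carrier R - Units R" if "x \<in> carrier R - Units R" "y \<in> carrier R" for x y
    using mult[OF that] that by (simp add: m_comm)
  ultimately show ?thesis
    using mult by (intro idealI ring_axioms)
qed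

lemma local_if_not_prime:
  assumes "\<not> primeideal I R"
  shows "local_cring R"
proof -
  \<comment> \<open>In the zero ring no ideal is proper, so the existence of \<open>I\<close> rules
    it out.\<close>
  have one: "\<one> \<noteq> \<zero>"
    using I_notcarr one_imp_carrier by auto
  have proper: "J \<subseteq> carrier R - Units R" if "ideal J R" "J \<noteq> carrier R" for J
    using ideal.proper_disjoint_Units[OF that] ideal.Icarr[OF that(1)] by blast
  have max: "maximalideal (carrier R - Units R) R"
    by (rule maximalidealI) (use nonunits_ideal[OF assms] proper in auto)
  \<comment> \<open>As a proper ideal, \<open>N\<close> lies inside the proper ideal of nonunits;
    maximality of \<open>N\<close> forces equality.\<close>
  moreover have "N = carrier R - Units R" if "maximalideal N R" for N
    using that proper[of N] maximalideal.I_maximal[OF that nonunits_ideal[OF assms]]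
      maximalideal.axioms(1)[OF that] maximalideal.I_notcarr[OF that] maximalideal.I_notcarr[OF max]
    by blast
  ultimately show ?thesis
    using one by unfold_locales auto
qed

lemma square_jacobson_radical_subset:
  assumes "\<not> primeideal I R"
  shows "jacobson_radical R \<cdot> jacobson_radical R \<subseteq> I"
proof
  interpret local_cring R
    using assms by (rule local_if_not_prime)
  fix x assume "x \<in> jacobson_radical R \<cdot> jacobson_radical R"
  then show "x \<in> I"
    \<comment> \<open>The induction runs over the construction of \<open>ideal_prod\<close>:
      products of two nonunits, and sums.\<close>
    by induction
      (use nonunit_mult_in_ideal[OF assms] jacobson_radical_eq_nonunits in auto)
qed

text \<open>In the non-prime case a unit \<open>b\<close> cancels, and a nonunit \<open>b\<close>
  has its square in \<open>I\<close>.\<close>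

lemma primary_ideal: "primary_ideal I R"
proof (cases "primeideal I R")
  case True
  then show ?thesis
    by (rule primeideal.primary_ideal)
next
  case False
  show ?thesis
  proof unfold_locales
    fix a b assume ab: "a \<in> carrier R" "b \<in> carrier R" "a \<otimes> b \<in> I"
    show "a \<in> I \<or> (\<exists>n::nat. n > 0 \<and> b [^] n \<in> I)"
    proof (cases "b \<in> Units R")
      case True
      then show ?thesis
        using unit_mult_cancel[of b a] ab by (simp add: m_comm)
    next
      case nonunit: False
      have "b [^] (2::nat) \<in> I"
        using nonunit_mult_in_ideal[OF False, of b b] nonunit ab
        by (simp add: numeral_2_eq_2)
      then show ?thesis
        using zero_less_numeral by blast
    qed
  qed (rule I_notcarr)
qed

text \<open>In the non-prime case a unit among \<open>a\<close> and \<open>b\<close> cancels,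
  leaving the product of the other two elements; if both are nonunits, their product is already in
  \<open>I\<close>.\<close>

lemma ta_ideal: "ta_ideal I R"
proof (cases "primeideal I R")
  case True
  then show ?thesis
    by (rule primeideal.ta_ideal)
next
  case False
  show ?thesis
  proof unfold_locales
    fix a b c assume abc: "a \<in> carrier R" "b \<in> carrier R" "c \<in> carrier R" "a \<otimes> b \<otimes> c \<in> I"
    have "b \<otimes> c \<in> I" if "a \<in> Units R"
      using unit_mult_cancel[OF that, of "b \<otimes> c"] abc by (simp add: m_assoc)
    moreover have "a \<otimes> c \<in> I" if "b \<in> Units R"
      using unit_mult_cancel[OF that, of "a \<otimes> c"] abc by (simp add: m_ac)
    ultimately show "a \<otimes> b \<in> I \<or> a \<otimes> c \<in> I \<or> b \<otimes> c \<in> I"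
      using nonunit_mult_in_ideal[OF False, of a b] abc by blast
  qed (rule I_notcarr)
qed

end

section \<open>Factorizations into OA-ideals\<close>

lemma is_finite_ideal_prod_mono:
  assumes "is_finite_ideal_prod R P I" "\<And>J. P J \<Longrightarrow> Q J"
  shows "is_finite_ideal_prod R Q I"
  using assms unfolding is_finite_ideal_prod_def by blast

lemma (in oaf_ring) q_ring: "q_ring R"
  by unfold_locales (blast intro: is_finite_ideal_prod_mono oa_factorization oa_ideal.primary_ideal)

lemma (in oaf_ring) taf_ring: "taf_ring R"
  by unfold_locales (blast intro: is_finite_ideal_prod_mono oa_factorization oa_ideal.ta_ideal)

theorem lemma2p1:
  fixes R :: "('a, 'b) ring_scheme" (structure) and M I :: "'a set"
  assumes "nonzero_cring R"
    and "M = jacobson_radical R"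
    and "ideal I R"
  shows "(\<not> local_cring R \<longrightarrow> (oa_ideal I R \<longleftrightarrow> primeideal I R)) \<and>
    (local_cring R \<longrightarrow>
      (oa_ideal I R \<longleftrightarrow> primeideal I R \<or> (M \<cdot> M \<subseteq> I \<and> I \<subseteq> M))) \<and>
    (\<forall>J. oa_ideal J R \<longrightarrow> primary_ideal J R \<and> ta_ideal J R) \<and>
    (oaf_ring R \<longrightarrow> q_ring R \<and> taf_ring R)"
proof (intro conjI impI allI)
  assume "\<not> local_cring R"
  \<comment> \<open>By contraposition: a non-prime OA-ideal makes the ring local.\<close>
  then show "oa_ideal I R \<longleftrightarrow> primeideal I R"
    using oa_ideal.local_if_not_prime primeideal.oa_ideal by blast
next
  assume loc: "local_cring R"
  have "M \<cdot> M \<subseteq> I \<and> I \<subseteq> M" if "oa_ideal I R" "\<not> primeideal I R"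
    using oa_ideal.square_jacobson_radical_subset[OF that] oa_ideal.I_notcarr[OF that(1)]
      local_cring.proper_ideal_subset_jacobson_radical[OF loc assms(3)] assms(2)
    by blast
  then show "oa_ideal I R \<longleftrightarrow> primeideal I R \<or> (M \<cdot> M \<subseteq> I \<and> I \<subseteq> M)"
    using primeideal.oa_ideal assms(2)
      local_cring.oa_ideal_if_square_jacobson_radical_subset[OF loc assms(3)]
    by blast
qed (blast intro: oa_ideal.primary_ideal oa_ideal.ta_ideal oaf_ring.q_ring oaf_ring.taf_ring)+

end
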